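(* Let $(X,T,F)$ be a ternary $f$-quandle and let $A$ be a non-empty set. Let $\alpha: X\times X\times X\to \mathrm{Fun}(A\times A\times A,A)$, $(x,y,z)\mapsto\alpha_{x,y,z}$, be a function and let $g:A\to A$ be a map. Then $X\times A$, with the ternary operation $$\big((x,a),(y,b),(z,c)\big)\longmapsto \big(T(x,y,z),\,\alpha_{x,y,z}(a,b,c)\big)$$ and the twisting map $(x,a)\mapsto (F(x),g(a))$, is a ternary $f$-quandle if and only if $\alpha$ satisfies the following conditions: (1) $\alpha_{x,x,x}(a,a,a)=g(a)$ for all $x\in X$ and $a\in A$; (2) for all $x,y,z\in X$ and all $b,c\in A$, the map $\alpha_{x,y,z}(-,b,c):A\to A$ is a bijection; (3) for all $x,y,z,u,v\in X$ and all $a,b,c,d,e\in A$, $$\alpha_{T(x,y,z),F(u),F(v)}\big(\alpha_{x,y,z}(a,b,c),g(d),g(e)\big)=\alpha_{T(x,u,v),T(y,u,v),T(z,u,v)}\big(\alpha_{x,u,v}(a,d,e),\alpha_{y,u,v}(b,d,e),\alpha_{z,u,v}(c,d,e)\big).$$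
   Context: A ternary $f$-quandle is a triple $(Q,T,\phi)$ where $Q$ is a set, $T:Q\times Q\times Q\to Q$ is a ternary operation and $\phi:Q\to Q$ is a morphism (i.e. $\phi(T(x,y,z))=T(\phi(x),\phi(y),\phi(z))$), called the twisting map, such that: (i) $T(T(x,y,z),\phi(u),\phi(v))=T(T(x,u,v),T(y,u,v),T(z,u,v))$ for all $x,y,z,u,v\in Q$; (ii) for all $a,b\in Q$, the map $R_{a,b}:Q\to Q$, $R_{a,b}(x)=T(x,a,b)$, is invertible; (iii) $T(x,x,x)=\phi(x)$ for all $x\in Q$. $\mathrm{Fun}(A\times A\times A,A)$ denotes the set of all functions $A\times A\times A\to A$. *)

theory Defs
  imports Main "HOL-Library.FuncSet"
begin

text \<open>
  Structures live on carrier sets; operations are total functions on the ambient type whose values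
  outside the carrier are irrelevant. The carrier may be empty.
\<close>

locale ternary_f_quandle =
  fixes Q :: "'q set"
    and T :: "'q \<times> 'q \<times> 'q \<Rightarrow> 'q"
    and \<phi> :: "'q \<Rightarrow> 'q"
  assumes op_closed: "T \<in> Q \<times> Q \<times> Q \<rightarrow> Q"
    and twist_closed: "\<phi> \<in> Q \<rightarrow> Q"
    and twist_morphism:
      "\<lbrakk>x \<in> Q; y \<in> Q; z \<in> Q\<rbrakk> \<Longrightarrow> \<phi> (T (x, y, z)) = T (\<phi> x, \<phi> y, \<phi> z)"
    and distrib:
      "\<lbrakk>x \<in> Q; y \<in> Q; z \<in> Q; u \<in> Q; v \<in> Q\<rbrakk> \<Longrightarrow>
        T (T (x, y, z), \<phi> u, \<phi> v) = T (T (x, u, v), T (y, u, v), T (z, u, v))"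
    and right_invertible:
      "\<lbrakk>a \<in> Q; b \<in> Q\<rbrakk> \<Longrightarrow> bij_betw (\<lambda>x. T (x, a, b)) Q Q"
    and diagonal: "x \<in> Q \<Longrightarrow> T (x, x, x) = \<phi> x"

end

theory Submission imports Defs begin

text \<open>
  The identities defining a ternary \<open>f\<close>-quandle on \<open>X \<times> A\<close> are equations between pairs whose first
  components agree by the same identities on \<open>X\<close>. Hence only the second components say anything new:
  diagonality becomes \<open>\<alpha> (x, x, x) (a, a, a) = g a\<close>, and distributivity becomes the cocycle equation
  that relates \<open>\<alpha>\<close> at \<open>(T (x, y, z), F u, F v)\<close> to \<open>\<alpha>\<close> at \<open>(T (x, u, v), T (y, u, v), T (z, u, v))\<close>.

  Two axioms are not matched with a condition on \<open>\<alpha>\<close> this directly. A right translation of \<open>X \<times> A\<close>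
  covers a right translation of \<open>X\<close>, which is a bijection; such a map is a bijection exactly when it
  is one on every fibre (\<open>bij_betw_skew_product_iff\<close>). And none of the conditions expresses that the
  twisting map is a morphism: this follows from distributivity and diagonality
  (\<open>twist_morphism_if_distrib_diagonal\<close>).
\<close>

text \<open>
  Expanding \<open>\<phi> x\<close> as \<open>T (x, x, x)\<close> and distributing gives
  \<open>T (\<phi> x, \<phi> y, \<phi> z) = T (t, t, t)\<close> with \<open>t = T (x, y, z)\<close>, and this is \<open>\<phi> t\<close>.
\<close>

lemma twist_morphism_if_distrib_diagonal:
  assumes closed: "T \<in> Q \<times> Q \<times> Q \<rightarrow> Q"
    and distrib: "\<And>x y z u v. \<lbrakk>x \<in> Q; y \<in> Q; z \<in> Q; u \<in> Q; v \<in> Q\<rbrakk> \<Longrightarrow>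
        T (T (x, y, z), \<phi> u, \<phi> v) = T (T (x, u, v), T (y, u, v), T (z, u, v))"
    and diagonal: "\<And>x. x \<in> Q \<Longrightarrow> T (x, x, x) = \<phi> x"
    and xyz: "x \<in> Q" "y \<in> Q" "z \<in> Q"
  shows "\<phi> (T (x, y, z)) = T (\<phi> x, \<phi> y, \<phi> z)"
proof -
  have "T (x, y, z) \<in> Q"
    using closed xyz by auto
  then have "\<phi> (T (x, y, z)) = T (T (x, y, z), T (x, y, z), T (x, y, z))"
    by (simp add: diagonal)
  also have "\<dots> = T (T (x, x, x), \<phi> y, \<phi> z)"
    using xyz by (simp only: distrib)
  finally show ?thesis
    using xyz by (simp only: diagonal)
qed

text \<open>
  Since the base map \<open>h\<close> is injective, two points with images in the same fibre lie in the same
  fibre; so injectivity and surjectivity can both be tested one fibre at a time.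
\<close>

lemma bij_betw_skew_product_iff:
  assumes h: "bij_betw h X Y"
  shows "bij_betw (\<lambda>(x, a). (h x, k x a)) (X \<times> A) (Y \<times> B)
    \<longleftrightarrow> (\<forall>x\<in>X. bij_betw (k x) A B)"
    (is "bij_betw ?f _ _ \<longleftrightarrow> _")
proof
  assume f: "bij_betw ?f (X \<times> A) (Y \<times> B)"
  show "\<forall>x\<in>X. bij_betw (k x) A B"
  proof
    fix x assume x: "x \<in> X"
    then have hx: "h x \<in> Y"
      using h by (rule bij_betwE[rule_format, rotated])
    show "bij_betw (k x) A B"
      unfolding bij_betw_def
    proof
      show "inj_on (k x) A"
      proof (rule inj_onI)
        fix a b assume "a \<in> A" "b \<in> A" "k x a = k x b"
        then show "a = b"
          using inj_onD[OF bij_betw_imp_inj_on[OF f], of "(x, a)" "(x, b)"] x by simp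
      qed
      show "k x ` A = B"
      proof
        show "k x ` A \<subseteq> B"
          using bij_betwE[OF f] x by auto
        show "B \<subseteq> k x ` A"
        proof
          fix b assume "b \<in> B"
          then have "(h x, b) \<in> ?f ` (X \<times> A)"
            using hx bij_betw_imp_surj_on[OF f] by simp
          then obtain x' a where "x' \<in> X" "a \<in> A" "h x = h x'" "b = k x' a"
            by auto
          moreover from this x have "x' = x"
            using bij_betw_imp_inj_on[OF h] by (auto dest: inj_onD)
          ultimately show "b \<in> k x ` A"
            by simp
        qed
      qed
    qed
  qed
next
  assume k: "\<forall>x\<in>X. bij_betw (k x) A B"
  have "inj_on ?f (X \<times> A)"
  proof (rule inj_onI, clarify)
    fix x a x' a'
    assume *: "x \<in> X" "x' \<in> X" "a \<in> A" "a' \<in> A" "h x = h x'" "k x a = k x' a'"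
    then have "x = x'"
      using bij_betw_imp_inj_on[OF h] by (auto dest: inj_onD)
    with * k show "x = x' \<and> a = a'"
      by (auto simp: bij_betw_def dest: inj_onD)
  qed
  moreover have "?f ` (X \<times> A) = (SIGMA y:h ` X. B)"
  proof -
    have "?f ` (X \<times> A) = (\<Union>x\<in>X. {h x} \<times> k x ` A)"
      by auto
    also have "\<dots> = (\<Union>x\<in>X. {h x} \<times> B)"
      using k by (simp add: bij_betw_def)
    finally show ?thesis
      by auto
  qed
  ultimately show "bij_betw ?f (X \<times> A) (Y \<times> B)"
    using h by (simp add: bij_betw_def)
qed

theorem proposition5p1:
  fixes X :: "'x set" and T :: "'x \<times> 'x \<times> 'x \<Rightarrow> 'x" and F :: "'x \<Rightarrow> 'x"
    and A :: "'a set" and g :: "'a \<Rightarrow> 'a"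
    and \<alpha> :: "'x \<times> 'x \<times> 'x \<Rightarrow> 'a \<times> 'a \<times> 'a \<Rightarrow> 'a"
  assumes "ternary_f_quandle X T F"
    and "A \<noteq> {}"
    and "\<alpha> \<in> X \<times> X \<times> X \<rightarrow> (A \<times> A \<times> A \<rightarrow> A)"
    and "g \<in> A \<rightarrow> A"
  shows "ternary_f_quandle (X \<times> A)
           (\<lambda>((x, a), (y, b), (z, c)). (T (x, y, z), \<alpha> (x, y, z) (a, b, c)))
           (\<lambda>(x, a). (F x, g a))
    \<longleftrightarrow>
      (\<forall>x\<in>X. \<forall>a\<in>A. \<alpha> (x, x, x) (a, a, a) = g a) \<and>
      (\<forall>x\<in>X. \<forall>y\<in>X. \<forall>z\<in>X. \<forall>b\<in>A. \<forall>c\<in>A.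
         bij_betw (\<lambda>a. \<alpha> (x, y, z) (a, b, c)) A A) \<and>
      (\<forall>x\<in>X. \<forall>y\<in>X. \<forall>z\<in>X. \<forall>u\<in>X. \<forall>v\<in>X.
       \<forall>a\<in>A. \<forall>b\<in>A. \<forall>c\<in>A. \<forall>d\<in>A. \<forall>e\<in>A.
         \<alpha> (T (x, y, z), F u, F v) (\<alpha> (x, y, z) (a, b, c), g d, g e) =
         \<alpha> (T (x, u, v), T (y, u, v), T (z, u, v))
           (\<alpha> (x, u, v) (a, d, e), \<alpha> (y, u, v) (b, d, e), \<alpha> (z, u, v) (c, d, e)))"
proof -
  interpret base: ternary_f_quandle X T F
    by (rule assms(1))
  let ?S = "\<lambda>((x, a), (y, b), (z, c)). (T (x, y, z), \<alpha> (x, y, z) (a, b, c))"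
  let ?G = "\<lambda>(x, a). (F x, g a)"
  have T_closed: "T (x, y, z) \<in> X" if "x \<in> X" "y \<in> X" "z \<in> X" for x y z
    using base.op_closed that by auto
  have \<alpha>_closed: "\<alpha> (x, y, z) (a, b, c) \<in> A"
    if "x \<in> X" "y \<in> X" "z \<in> X" "a \<in> A" "b \<in> A" "c \<in> A" for x y z a b c
    using funcset_mem[OF assms(3), of "(x, y, z)"] that by auto
  have translation: "bij_betw (\<lambda>p. ?S (p, (y, b), (z, c))) (X \<times> A) (X \<times> A)
      \<longleftrightarrow> (\<forall>x\<in>X. bij_betw (\<lambda>a. \<alpha> (x, y, z) (a, b, c)) A A)"
    if "y \<in> X" "z \<in> X" for y z b c
    using bij_betw_skew_product_iff
        [OF base.right_invertible[OF that], of "\<lambda>x a. \<alpha> (x, y, z) (a, b, c)" A A]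
    by (simp add: case_prod_beta')
  show ?thesis (is "?quandle \<longleftrightarrow> ?diag \<and> ?bij \<and> ?cocycle")
  proof
    assume ?quandle
    then interpret ext: ternary_f_quandle "X \<times> A" ?S ?G .
    have ?diag
    proof (intro ballI)
      fix x a assume "x \<in> X" "a \<in> A"
      then show "\<alpha> (x, x, x) (a, a, a) = g a"
        using ext.diagonal[of "(x, a)"] by simp
    qed
    moreover have ?bij
    proof (intro ballI)
      fix x y z b c assume *: "x \<in> X" "y \<in> X" "z \<in> X" "b \<in> A" "c \<in> A"
      then have "bij_betw (\<lambda>p. ?S (p, (y, b), (z, c))) (X \<times> A) (X \<times> A)"
        by (intro ext.right_invertible) simp_all
      with * show "bij_betw (\<lambda>a. \<alpha> (x, y, z) (a, b, c)) A A"
        by (simp only: translation)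
    qed
    moreover have ?cocycle
    proof (intro ballI)
      fix x y z u v a b c d e
      assume "x \<in> X" "y \<in> X" "z \<in> X" "u \<in> X" "v \<in> X"
        "a \<in> A" "b \<in> A" "c \<in> A" "d \<in> A" "e \<in> A"
      then show "\<alpha> (T (x, y, z), F u, F v) (\<alpha> (x, y, z) (a, b, c), g d, g e) =
          \<alpha> (T (x, u, v), T (y, u, v), T (z, u, v))
            (\<alpha> (x, u, v) (a, d, e), \<alpha> (y, u, v) (b, d, e), \<alpha> (z, u, v) (c, d, e))"
        using ext.distrib[of "(x, a)" "(y, b)" "(z, c)" "(u, d)" "(v, e)"] by simp
    qed
    ultimately show "?diag \<and> ?bij \<and> ?cocycle"
      by blast
  next
    assume "?diag \<and> ?bij \<and> ?cocycle"
    then have diag: ?diag and bij: ?bij and cocycle: ?cocycle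
      by blast+
    have closed: "?S \<in> (X \<times> A) \<times> (X \<times> A) \<times> (X \<times> A) \<rightarrow> X \<times> A"
      by (auto simp: T_closed \<alpha>_closed)
    have distrib: "?S (?S (p, q, r), ?G s, ?G t) = ?S (?S (p, s, t), ?S (q, s, t), ?S (r, s, t))"
      if "p \<in> X \<times> A" "q \<in> X \<times> A" "r \<in> X \<times> A" "s \<in> X \<times> A" "t \<in> X \<times> A" for p q r s t
      using that cocycle by (auto simp: base.distrib)
    have diagonal: "?S (p, p, p) = ?G p" if "p \<in> X \<times> A" for p
      using that diag by (auto simp: base.diagonal)
    show ?quandle
    proof
      show "?S \<in> (X \<times> A) \<times> (X \<times> A) \<times> (X \<times> A) \<rightarrow> X \<times> A"
        by (rule closed)
      show "?G \<in> X \<times> A \<rightarrow> X \<times> A"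
        using base.twist_closed assms(4) by auto
      show "?S (?S (p, q, r), ?G s, ?G t) = ?S (?S (p, s, t), ?S (q, s, t), ?S (r, s, t))"
        if "p \<in> X \<times> A" "q \<in> X \<times> A" "r \<in> X \<times> A" "s \<in> X \<times> A" "t \<in> X \<times> A" for p q r s t
        using that by (rule distrib)
      show "?S (p, p, p) = ?G p" if "p \<in> X \<times> A" for p
        using that by (rule diagonal)
      show "?G (?S (p, q, r)) = ?S (?G p, ?G q, ?G r)"
        if "p \<in> X \<times> A" "q \<in> X \<times> A" "r \<in> X \<times> A" for p q r
        using closed distrib diagonal that by (rule twist_morphism_if_distrib_diagonal)
      show "bij_betw (\<lambda>p. ?S (p, q, r)) (X \<times> A) (X \<times> A)"
        if qr: "q \<in> X \<times> A" "r \<in> X \<times> A" for q r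
      proof -
        obtain y b z c where "q = (y, b)" "r = (z, c)" "y \<in> X" "b \<in> A" "z \<in> X" "c \<in> A"
          using qr by blast
        with bij show ?thesis
          by (simp only: translation) blast
      qed
    qed
  qed
qed

end
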